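(* Let $G$ be a finite simple graph and $\kappa:E(G)\to[k]$ a proper edge coloring of $G$. Then the centralizer $C_{S_{V(G)}}(\mathfrak{G}_\kappa)$ of the coloring group $\mathfrak{G}_\kappa$ in the symmetric group $S_{V(G)}$ is isomorphic to $\operatorname{Aut}_\kappa(G)$.
   Context: A proper edge coloring of a graph $G$ on $k$ colors is a surjective map $\kappa:E(G)\to[k]$ such that any two edges sharing a vertex receive different colors. For $a\in[k]$, let $\tau_a\in S_{V(G)}$ be the product of the transpositions $(i,j)$ over all edges $\{i,j\}$ with $\kappa(\{i,j\})=a$ (these transpositions are disjoint, so the order does not matter). The coloring group $\mathfrak{G}_\kappa$ is the subgroup of $S_{V(G)}$ generated by $\tau_1,\dots,\tau_k$. The group $\operatorname{Aut}_\kappa(G)$ consists of all permutations $\sigma\in S_{V(G)}$ such that for every color $a$, $\{i,j\}$ is an edge of $G$ colored $a$ if and only if $\{\sigma(i),\sigma(j)\}$ is an edge of $G$ colored $a$. *)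

theory Defs
  imports "HOL-Algebra.Sym_Groups"
begin

section \<open>Finite simple graphs and proper edge colorings\<close>

definition fin_simple_graph :: "'a set \<Rightarrow> 'a set set \<Rightarrow> bool" where
  "fin_simple_graph V E \<longleftrightarrow>
     finite V \<and> (\<forall>e\<in>E. \<exists>u\<in>V. \<exists>v\<in>V. u \<noteq> v \<and> e = {u, v})"

text \<open>The color set $[k]$ is \<open>{1..k}\<close>; only the values of \<open>\<kappa>\<close> on \<open>E\<close> matter.\<close>

definition proper_edge_coloring :: "'a set set \<Rightarrow> nat \<Rightarrow> ('a set \<Rightarrow> nat) \<Rightarrow> bool" where
  "proper_edge_coloring E k \<kappa> \<longleftrightarrow>
     \<kappa> ` E = {1..k} \<and>
     (\<forall>e\<in>E. \<forall>f\<in>E. e \<noteq> f \<and> e \<inter> f \<noteq> {} \<longrightarrow> \<kappa> e \<noteq> \<kappa> f)"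


section \<open>The symmetric group on a set and centralizers\<close>

text \<open>Same construction as \<^const>\<open>sym_group\<close>, for an arbitrary set instead of \<open>{1..n}\<close>.\<close>

definition sym_group_on :: "'a set \<Rightarrow> ('a \<Rightarrow> 'a) monoid" where
  "sym_group_on V = \<lparr> carrier = {p. p permutes V}, mult = (\<circ>), one = id \<rparr>"

lemma sym_group_eq_sym_group_on: "sym_group n = sym_group_on {1..n}"
  by (simp add: sym_group_def sym_group_on_def)

lemma sym_group_on_simps [simp]:
  "carrier (sym_group_on V) = {p. p permutes V}"
  "mult (sym_group_on V) = (\<circ>)"
  "one (sym_group_on V) = id"
  by (simp_all add: sym_group_on_def)

lemma group_sym_group_on: "group (sym_group_on V)"
proof (rule groupI)
  fix p assume "p \<in> carrier (sym_group_on V)"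
  then show "\<exists>q\<in>carrier (sym_group_on V). q \<otimes>\<^bsub>sym_group_on V\<^esub> p = \<one>\<^bsub>sym_group_on V\<^esub>"
    by (auto intro: exI[of _ "inv' p"] simp: permutes_inv permutes_inv_o)
qed (auto simp: permutes_compose permutes_id comp_assoc)

definition centralizer :: "('g, 'm) monoid_scheme \<Rightarrow> 'g set \<Rightarrow> 'g set" where
  "centralizer G H = {g \<in> carrier G. \<forall>h\<in>H. g \<otimes>\<^bsub>G\<^esub> h = h \<otimes>\<^bsub>G\<^esub> g}"

lemma (in group) subgroup_centralizer:
  assumes "H \<subseteq> carrier G"
  shows "subgroup (centralizer G H) G"
proof (rule subgroupI)
  fix a assume a: "a \<in> centralizer G H"
  have "inv a \<otimes> h = h \<otimes> inv a" if "h \<in> H" for h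
  proof -
    have h: "h \<in> carrier G" "a \<in> carrier G" "a \<otimes> h = h \<otimes> a"
      using that a assms by (auto simp: centralizer_def)
    have "a \<otimes> (inv a \<otimes> h) = h"
      using h(1,2) by (simp flip: m_assoc)
    moreover have "a \<otimes> (h \<otimes> inv a) = (h \<otimes> a) \<otimes> inv a"
      unfolding h(3)[symmetric] using h(1,2) by (simp add: m_assoc)
    moreover have "(h \<otimes> a) \<otimes> inv a = h"
      using h(1,2) by (simp add: m_assoc)
    ultimately have "a \<otimes> (inv a \<otimes> h) = a \<otimes> (h \<otimes> inv a)"
      by simp
    with h(1,2) show ?thesis by simp
  qed
  with a show "inv a \<in> centralizer G H" by (auto simp: centralizer_def)
next
  fix a b assume ab: "a \<in> centralizer G H" "b \<in> centralizer G H"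
  have "(a \<otimes> b) \<otimes> h = h \<otimes> (a \<otimes> b)" if "h \<in> H" for h
  proof -
    have h: "h \<in> carrier G" "a \<in> carrier G" "b \<in> carrier G"
      "a \<otimes> h = h \<otimes> a" "b \<otimes> h = h \<otimes> b"
      using that ab assms by (auto simp: centralizer_def)
    have "(a \<otimes> b) \<otimes> h = a \<otimes> (h \<otimes> b)"
      using h(1-3) by (simp add: m_assoc h(5))
    also have "\<dots> = (h \<otimes> a) \<otimes> b"
      unfolding h(4)[symmetric] using h(1-3) by (simp add: m_assoc)
    finally show ?thesis using h(1-3) by (simp add: m_assoc)
  qed
  with ab show "a \<otimes> b \<in> centralizer G H" by (auto simp: centralizer_def)
next
  have "\<one> \<in> centralizer G H" using assms by (auto simp: centralizer_def)
  then show "centralizer G H \<noteq> {}" by blast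
qed (auto simp: centralizer_def)


section \<open>The coloring group\<close>

definition edge_transposition :: "'a set \<Rightarrow> 'a \<Rightarrow> 'a" where
  "edge_transposition e = (THE p. \<exists>i j. e = {i, j} \<and> p = transpose i j)"

lemma edge_transposition_pair [simp]: "edge_transposition {i, j} = transpose i j"
  unfolding edge_transposition_def
  by (rule the_equality) (auto simp: doubleton_eq_iff transpose_commute)

text \<open>
  The product of the edge transpositions over a color class. \<^const>\<open>Finite_Set.fold\<close> is
  meaningful here because the transpositions commute; \<open>color_perm_eq_list_product\<close> below states
  that any enumeration of the color class yields this product.
\<close>

definition color_perm :: "'a set set \<Rightarrow> ('a set \<Rightarrow> nat) \<Rightarrow> nat \<Rightarrow> 'a \<Rightarrow> 'a" where
  "color_perm E \<kappa> a =
     Finite_Set.fold (\<lambda>e p. edge_transposition e \<circ> p) id {e \<in> E. \<kappa> e = a}"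

lemma edge_transposition_commute:
  assumes "fin_simple_graph V E" "proper_edge_coloring E k \<kappa>"
    and "e \<in> E" "f \<in> E" "\<kappa> e = \<kappa> f"
  shows "edge_transposition e \<circ> edge_transposition f
       = edge_transposition f \<circ> edge_transposition e"
proof (cases "e = f")
  case False
  then have disj: "e \<inter> f = {}"
    using assms unfolding proper_edge_coloring_def by blast
  obtain i j where e: "e = {i, j}"
    using assms unfolding fin_simple_graph_def by blast
  obtain u v where f: "f = {u, v}"
    using assms unfolding fin_simple_graph_def by blast
  from disj e f have "i \<noteq> u" "i \<noteq> v" "j \<noteq> u" "j \<noteq> v" by auto
  then show ?thesis unfolding e f edge_transposition_pair
    by (rule swap_id_independent)
qed simp

lemma color_perm_eq_list_product:
  assumes "fin_simple_graph V E" "proper_edge_coloring E k \<kappa>"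
    and "distinct es" "set es = {e \<in> E. \<kappa> e = a}"
  shows "color_perm E \<kappa> a = foldr (\<circ>) (map edge_transposition es) id"
proof -
  interpret comp_fun_commute_on "{e \<in> E. \<kappa> e = a}" "\<lambda>e p. edge_transposition e \<circ> p"
  proof
    fix e f assume "e \<in> {e \<in> E. \<kappa> e = a}" "f \<in> {e \<in> E. \<kappa> e = a}"
    then have "edge_transposition f \<circ> edge_transposition e
       = edge_transposition e \<circ> edge_transposition f"
      using edge_transposition_commute[OF assms(1,2)] by auto
    then show "(\<circ>) (edge_transposition f) \<circ> (\<circ>) (edge_transposition e)
       = (\<circ>) (edge_transposition e) \<circ> (\<circ>) (edge_transposition f)"
      by (simp add: fun_eq_iff)
  qed
  have "Finite_Set.fold (\<lambda>e p. edge_transposition e \<circ> p) id (set xs)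
      = foldr (\<circ>) (map edge_transposition xs) id"
    if "distinct xs" "set xs \<subseteq> {e \<in> E. \<kappa> e = a}" for xs
    using that
  proof (induction xs)
    case (Cons x xs)
    have IH: "Finite_Set.fold (\<lambda>e p. edge_transposition e \<circ> p) id (set xs)
      = foldr (\<circ>) (map edge_transposition xs) id"
      by (rule Cons.IH) (use Cons.prems in auto)
    have "Finite_Set.fold (\<lambda>e p. edge_transposition e \<circ> p) id (insert x (set xs))
      = edge_transposition x \<circ> Finite_Set.fold (\<lambda>e p. edge_transposition e \<circ> p) id (set xs)"
      using Cons.prems by (intro fold_insert) auto
    moreover have "foldr (\<circ>) (map edge_transposition (x # xs)) id
      = edge_transposition x \<circ> foldr (\<circ>) (map edge_transposition xs) id"
      by simp
    ultimately show ?case by (simp only: IH list.set)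
  qed simp
  from this[OF assms(3)] show ?thesis
    unfolding assms(4) color_perm_def by blast
qed

lemma color_perm_permutes:
  assumes "fin_simple_graph V E" "proper_edge_coloring E k \<kappa>"
  shows "color_perm E \<kappa> a permutes V"
proof -
  have edge: "\<exists>u\<in>V. \<exists>v\<in>V. e = {u, v}" if "e \<in> E" for e
    using assms(1) that unfolding fin_simple_graph_def by blast
  then have "E \<subseteq> Pow V" by fastforce
  moreover have "finite (Pow V)" using assms(1) by (simp add: fin_simple_graph_def)
  ultimately have "finite E" by (rule finite_subset)
  then have "finite {e \<in> E. \<kappa> e = a}" by simp
  then obtain es where es: "distinct es" "set es = {e \<in> E. \<kappa> e = a}"
    using finite_distinct_list by blast
  have "foldr (\<circ>) (map edge_transposition xs) id permutes V" if "set xs \<subseteq> E" for xs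
    using that
  proof (induction xs)
    case (Cons x xs)
    then obtain u v where "u \<in> V" "v \<in> V" "x = {u, v}"
      using edge[of x] by auto
    then have "edge_transposition x permutes V" by (simp add: permutes_swap_id)
    moreover have "foldr (\<circ>) (map edge_transposition xs) id permutes V"
      by (rule Cons.IH) (use Cons.prems in auto)
    ultimately have "edge_transposition x \<circ> foldr (\<circ>) (map edge_transposition xs) id permutes V"
      by (intro permutes_compose)
    moreover have "foldr (\<circ>) (map edge_transposition (x # xs)) id
      = edge_transposition x \<circ> foldr (\<circ>) (map edge_transposition xs) id"
      by simp
    ultimately show ?case by (simp only:)
  qed (simp add: permutes_id)
  then show ?thesis
    unfolding color_perm_eq_list_product[OF assms es] using es(2) by blast
qed

definition coloring_group :: "'a set \<Rightarrow> 'a set set \<Rightarrow> nat \<Rightarrow> ('a set \<Rightarrow> nat) \<Rightarrow> ('a \<Rightarrow> 'a) set" where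
  "coloring_group V E k \<kappa> = generate (sym_group_on V) (color_perm E \<kappa> ` {1..k})"

lemma subgroup_coloring_group:
  assumes "fin_simple_graph V E" "proper_edge_coloring E k \<kappa>"
  shows "subgroup (coloring_group V E k \<kappa>) (sym_group_on V)"
  unfolding coloring_group_def
  by (rule group.generate_is_subgroup[OF group_sym_group_on])
    (auto intro: color_perm_permutes[OF assms])


section \<open>Color-preserving automorphisms\<close>

definition color_aut :: "'a set \<Rightarrow> 'a set set \<Rightarrow> nat \<Rightarrow> ('a set \<Rightarrow> nat) \<Rightarrow> ('a \<Rightarrow> 'a) set" where
  "color_aut V E k \<kappa> =
     {\<sigma>. \<sigma> permutes V \<and>
         (\<forall>a\<in>{1..k}. \<forall>i\<in>V. \<forall>j\<in>V.
            ({i, j} \<in> E \<and> \<kappa> {i, j} = a) \<longleftrightarrow> ({\<sigma> i, \<sigma> j} \<in> E \<and> \<kappa> {\<sigma> i, \<sigma> j} = a))}"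

lemma subgroup_color_aut: "subgroup (color_aut V E k \<kappa>) (sym_group_on V)"
proof -
  interpret S: group "sym_group_on V" by (rule group_sym_group_on)
  show ?thesis
  proof (rule S.subgroupI)
    fix p assume p: "p \<in> color_aut V E k \<kappa>"
    then have pV: "p permutes V" unfolding color_aut_def by blast
    have inv: "inv\<^bsub>sym_group_on V\<^esub> p = inv' p"
      using pV by (intro S.inv_equality) (auto simp: permutes_inv permutes_inv_o)
    have mem: "inv' p i \<in> V" if "i \<in> V" for i
      using pV that by (meson permutes_in_image permutes_inv)
    have p_inv: "p (inv' p i) = i" for i
      using pV by (simp add: permutes_inverses)
    have "({i, j} \<in> E \<and> \<kappa> {i, j} = a) \<longleftrightarrow>
        ({inv' p i, inv' p j} \<in> E \<and> \<kappa> {inv' p i, inv' p j} = a)"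
      if "a \<in> {1..k}" "i \<in> V" "j \<in> V" for a i j
    proof -
      have "({inv' p i, inv' p j} \<in> E \<and> \<kappa> {inv' p i, inv' p j} = a) \<longleftrightarrow>
          ({p (inv' p i), p (inv' p j)} \<in> E \<and> \<kappa> {p (inv' p i), p (inv' p j)} = a)"
        using p that mem unfolding color_aut_def by blast
      then show ?thesis unfolding p_inv by (rule sym)
    qed
    then show "inv\<^bsub>sym_group_on V\<^esub> p \<in> color_aut V E k \<kappa>"
      using permutes_inv[OF pV] unfolding inv color_aut_def by blast
  next
    fix p q assume p: "p \<in> color_aut V E k \<kappa>" and q: "q \<in> color_aut V E k \<kappa>"
    have pq: "p permutes V" "q permutes V"
      using p q by (auto simp only: color_aut_def)
    have mem: "q i \<in> V" if "i \<in> V" for i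
      using pq that by (simp add: permutes_in_image)
    have "({i, j} \<in> E \<and> \<kappa> {i, j} = a) \<longleftrightarrow>
        ({(p \<circ> q) i, (p \<circ> q) j} \<in> E \<and> \<kappa> {(p \<circ> q) i, (p \<circ> q) j} = a)"
      if "a \<in> {1..k}" "i \<in> V" "j \<in> V" for a i j
    proof -
      have "({i, j} \<in> E \<and> \<kappa> {i, j} = a) \<longleftrightarrow> ({q i, q j} \<in> E \<and> \<kappa> {q i, q j} = a)"
        using q that unfolding color_aut_def by blast
      also have "\<dots> \<longleftrightarrow> ({p (q i), p (q j)} \<in> E \<and> \<kappa> {p (q i), p (q j)} = a)"
        using p that mem unfolding color_aut_def by blast
      finally show ?thesis by (simp only: o_apply)
    qed
    then show "p \<otimes>\<^bsub>sym_group_on V\<^esub> q \<in> color_aut V E k \<kappa>"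
      using permutes_compose[OF pq(2,1)] unfolding color_aut_def sym_group_on_simps by blast
  next
    have "id \<in> color_aut V E k \<kappa>" by (simp add: color_aut_def permutes_id)
    then show "color_aut V E k \<kappa> \<noteq> {}" by blast
  qed (auto simp only: color_aut_def sym_group_on_simps)
qed

end

theory Submission
  imports Defs
begin

text \<open>
  The two groups coincide as sets of permutations. For \<open>i \<noteq> j\<close>, the edge \<open>{i, j}\<close> exists and has
  color \<open>a\<close> iff \<open>\<tau>\<^sub>a\<close> maps \<open>i\<close> to \<open>j\<close>, so the generators \<open>\<tau>\<^sub>a\<close> encode the colored graph: a
  permutation preserves the edges of color \<open>a\<close> iff it commutes with \<open>\<tau>\<^sub>a\<close>.
\<close>

text \<open>Commuting is symmetric: if \<open>g\<close> centralizes \<open>H\<close>, then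
  \<open>H\<close> lies in the centralizer of \<open>{g}\<close>. That centralizer is a subgroup, so
  it contains everything that \<open>H\<close> generates.\<close>

lemma (in group) centralizer_generate:
  assumes "H \<subseteq> carrier G"
  shows "centralizer G (generate G H) = centralizer G H"
proof
  show "centralizer G (generate G H) \<subseteq> centralizer G H"
    by (auto simp: centralizer_def intro: generate.incl)
  show "centralizer G H \<subseteq> centralizer G (generate G H)"
  proof
    fix g assume g: "g \<in> centralizer G H"
    then have gG: "g \<in> carrier G" by (simp add: centralizer_def)
    have "H \<subseteq> centralizer G {g}"
      using g assms by (auto simp: centralizer_def)
    moreover have "subgroup (centralizer G {g}) G"
      using gG by (intro subgroup_centralizer) simp
    ultimately have "generate G H \<subseteq> centralizer G {g}"
      by (rule generate_subgroup_incl)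
    then show "g \<in> centralizer G (generate G H)"
      using gG by (auto simp: centralizer_def)
  qed
qed

text \<open>Among disjoint transpositions at most one moves \<open>i\<close>. The second conjunct
  strengthens the induction: if \<open>{i, j}\<close> is the head edge, the tail has to fix
  \<open>i\<close> before the head swaps it.\<close>

lemma foldr_edge_transposition_apply:
  assumes "distinct es"
    and "\<And>e. e \<in> set es \<Longrightarrow> \<exists>u v. u \<noteq> v \<and> e = {u, v}"
    and "\<And>e f. e \<in> set es \<Longrightarrow> f \<in> set es \<Longrightarrow> e \<noteq> f \<Longrightarrow> e \<inter> f = {}"
  shows "({i, j} \<in> set es \<longrightarrow> foldr (\<circ>) (map edge_transposition es) id i = j) \<and>
         (i \<notin> \<Union>(set es) \<longrightarrow> foldr (\<circ>) (map edge_transposition es) id i = i)"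
  using assms
proof (induction es)
  case (Cons e es)
  define F where "F = foldr (\<circ>) (map edge_transposition es) id"
  obtain u v where uv: "u \<noteq> v" "e = {u, v}"
    using Cons.prems(2)[of e] by auto
  have IH: "({i, j} \<in> set es \<longrightarrow> F i = j) \<and> (i \<notin> \<Union>(set es) \<longrightarrow> F i = i)"
    unfolding F_def by (rule Cons.IH) (use Cons.prems in simp_all)
  have disj: "e \<inter> f = {}" if "f \<in> set es" for f
    using that Cons.prems(1) by (intro Cons.prems(3)) auto
  have step: "foldr (\<circ>) (map edge_transposition (e # es)) id i = transpose u v (F i)"
    by (simp add: uv F_def)
  have "transpose u v (F i) = j" if ij: "{i, j} \<in> set (e # es)"
  proof (cases "{i, j} = e")
    case True
    then have "i \<notin> \<Union>(set es)" using disj by blast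
    with True IH uv show ?thesis by (auto simp: doubleton_eq_iff)
  next
    case False
    with ij have "{i, j} \<in> set es" by simp
    moreover from disj[OF this] have "j \<noteq> u" "j \<noteq> v" using uv by auto
    ultimately show ?thesis using IH by simp
  qed
  moreover have "transpose u v (F i) = i" if "i \<notin> \<Union>(set (e # es))"
    using that IH uv by auto
  ultimately show ?case unfolding step by blast
qed simp

text \<open>This recovers the edges of color \<open>a\<close> from the permutation. Equality of
  \<open>i\<close> and \<open>j\<close> is excluded because a vertex on no edge of color
  \<open>a\<close> is fixed, while \<open>{i}\<close> is not an edge.\<close>

lemma color_perm_eq_iff:
  assumes G: "fin_simple_graph V E" and \<kappa>: "proper_edge_coloring E k \<kappa>" and "i \<noteq> j"
  shows "color_perm E \<kappa> a i = j \<longleftrightarrow> {i, j} \<in> E \<and> \<kappa> {i, j} = a"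
proof -
  have "E \<subseteq> Pow V" "finite V" using G unfolding fin_simple_graph_def by fastforce+
  then have "finite E" by (meson finite_Pow_iff finite_subset)
  then obtain es where es: "distinct es" "set es = {e \<in> E. \<kappa> e = a}"
    using finite_distinct_list[of "{e \<in> E. \<kappa> e = a}"] by auto
  have edge: "\<exists>u v. u \<noteq> v \<and> e = {u, v}" if "e \<in> set es" for e
    using G that es(2) unfolding fin_simple_graph_def by blast
  have disj: "e \<inter> f = {}" if "e \<in> set es" "f \<in> set es" "e \<noteq> f" for e f
  proof -
    have "e \<in> E" "f \<in> E" "\<kappa> e = \<kappa> f" using that es(2) by simp_all
    with \<kappa> \<open>e \<noteq> f\<close> show ?thesis unfolding proper_edge_coloring_def by blast
  qed
  \<comment> \<open>The endpoint \<open>l\<close> stays arbitrary: besides \<open>j\<close>, it will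
    be the other end of an edge at \<open>i\<close> that is not yet known to end in
    \<open>j\<close>.\<close>
  have apply_es: "({i, l} \<in> set es \<longrightarrow> color_perm E \<kappa> a i = l) \<and>
      (i \<notin> \<Union>(set es) \<longrightarrow> color_perm E \<kappa> a i = i)" for l
    unfolding color_perm_eq_list_product[OF G \<kappa> es]
    using es(1) edge disj by (rule foldr_edge_transposition_apply)
  show ?thesis
  proof
    assume ij: "color_perm E \<kappa> a i = j"
    with \<open>i \<noteq> j\<close> have "color_perm E \<kappa> a i \<noteq> i" by simp
    with apply_es[of j] have "i \<in> \<Union>(set es)" by argo
    then obtain e where e: "e \<in> set es" "i \<in> e" by blast
    from edge[OF e(1)] e(2) obtain l where l: "e = {i, l}" by blast
    with apply_es[of l] e ij have "l = j" by simp
    with e l es(2) show "{i, j} \<in> E \<and> \<kappa> {i, j} = a" by auto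
  next
    assume "{i, j} \<in> E \<and> \<kappa> {i, j} = a"
    then show "color_perm E \<kappa> a i = j"
      using apply_es[of j] es(2) by blast
  qed
qed

text \<open>Commuting means that \<sigma> preserves the graph of \<tau> as a relation. Its
  off-diagonal pairs suffice, since the fixed points of \<tau> are exactly the points in no such
  pair; only these pairs correspond to edges.\<close>

lemma commute_permutes_iff:
  assumes \<sigma>: "\<sigma> permutes V" and \<tau>: "\<tau> permutes V"
  shows "\<sigma> \<circ> \<tau> = \<tau> \<circ> \<sigma> \<longleftrightarrow>
    (\<forall>i\<in>V. \<forall>j\<in>V. i \<noteq> j \<longrightarrow> (\<tau> i = j \<longleftrightarrow> \<tau> (\<sigma> i) = \<sigma> j))" (is "?L \<longleftrightarrow> ?R")
proof
  assume ?L
  then show ?R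
    by (metis comp_apply permutes_inj[OF \<sigma>] injD)
next
  assume R: ?R
  show ?L
  proof
    fix i
    show "(\<sigma> \<circ> \<tau>) i = (\<tau> \<circ> \<sigma>) i"
    proof (cases "i \<in> V")
      case True
      then have \<tau>i: "\<tau> i \<in> V" and "\<tau> (\<sigma> i) \<in> V"
        using \<sigma> \<tau> by (simp_all add: permutes_in_image)
      \<comment> \<open>With \<open>j\<close> the preimage of \<open>\<tau> (\<sigma> i)\<close>
        under \<sigma>, commutation at \<open>i\<close> amounts to
        \<open>\<tau> i = j\<close>.\<close>
      then obtain j where j: "j \<in> V" "\<tau> (\<sigma> i) = \<sigma> j"
        using permutes_image[OF \<sigma>] by (metis imageE)
      have "\<tau> i = j"
      proof (cases "i = j")
        case False
        with R True j show ?thesis by blast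
      next
        \<comment> \<open>Here \<tau> fixes \<open>\<sigma> i\<close>, and \<open>?R\<close> is
          silent about the pair \<open>(i, i)\<close>. If \<tau> moved \<open>i\<close>, then
          \<open>?R\<close> for \<open>i\<close> and \<open>\<tau> i\<close> would contradict
          injectivity of \<sigma>.\<close>
        case eq: True
        show ?thesis
        proof (rule ccontr)
          assume "\<tau> i \<noteq> j"
          with eq have "i \<noteq> \<tau> i" by simp
          from R[rule_format, OF True \<tau>i this] have "\<tau> (\<sigma> i) = \<sigma> (\<tau> i)" by simp
          with j have "\<sigma> (\<tau> i) = \<sigma> j" by simp
          with \<open>\<tau> i \<noteq> j\<close> permutes_inj[OF \<sigma>] show False by (simp add: inj_eq)
        qed
      qed
      with j show ?thesis by simp
    next
      case False
      then show ?thesis using \<sigma> \<tau> by (simp add: permutes_not_in)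
    qed
  qed
qed

lemma centralizer_coloring_group:
  assumes G: "fin_simple_graph V E" and \<kappa>: "proper_edge_coloring E k \<kappa>"
  shows "centralizer (sym_group_on V) (coloring_group V E k \<kappa>) = color_aut V E k \<kappa>"
proof -
  interpret S: group "sym_group_on V" by (rule group_sym_group_on)
  \<comment> \<open>\<open>color_aut\<close> also quantifies over \<open>i = j\<close>; there both
    sides of its equivalence are false.\<close>
  have no_loop: "{i} \<notin> E" for i
    using G unfolding fin_simple_graph_def by fastforce
  have "\<sigma> \<circ> color_perm E \<kappa> a = color_perm E \<kappa> a \<circ> \<sigma> \<longleftrightarrow>
      (\<forall>i\<in>V. \<forall>j\<in>V. ({i, j} \<in> E \<and> \<kappa> {i, j} = a) \<longleftrightarrow> ({\<sigma> i, \<sigma> j} \<in> E \<and> \<kappa> {\<sigma> i, \<sigma> j} = a))"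
    if \<sigma>: "\<sigma> permutes V" for \<sigma> a
  proof -
    have "(i \<noteq> j \<longrightarrow> (color_perm E \<kappa> a i = j \<longleftrightarrow> color_perm E \<kappa> a (\<sigma> i) = \<sigma> j)) \<longleftrightarrow>
        (({i, j} \<in> E \<and> \<kappa> {i, j} = a) \<longleftrightarrow> ({\<sigma> i, \<sigma> j} \<in> E \<and> \<kappa> {\<sigma> i, \<sigma> j} = a))" for i j
    proof (cases "i = j")
      case True
      then show ?thesis using no_loop by simp
    next
      case False
      moreover from False have "\<sigma> i \<noteq> \<sigma> j" using permutes_inj[OF \<sigma>] by (simp add: inj_eq)
      ultimately show ?thesis by (simp add: color_perm_eq_iff[OF G \<kappa>])
    qed
    then show ?thesis
      unfolding commute_permutes_iff[OF \<sigma> color_perm_permutes[OF G \<kappa>]] by presburger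
  qed
  moreover have "centralizer (sym_group_on V) (coloring_group V E k \<kappa>) =
      {\<sigma>. \<sigma> permutes V \<and> (\<forall>a\<in>{1..k}. \<sigma> \<circ> color_perm E \<kappa> a = color_perm E \<kappa> a \<circ> \<sigma>)}"
  proof -
    have "color_perm E \<kappa> ` {1..k} \<subseteq> carrier (sym_group_on V)"
      using color_perm_permutes[OF G \<kappa>] by (simp add: image_subset_iff)
    from S.centralizer_generate[OF this] show ?thesis
      by (simp add: coloring_group_def centralizer_def)
  qed
  \<comment> \<open>The equivalence holds only for permutations of \<open>V\<close>;
    \<open>conj_cong\<close> supplies that conjunct as a premise when rewriting the other.\<close>
  ultimately show ?thesis by (simp add: color_aut_def cong: conj_cong)
qed

theorem theorem3p1:
  fixes V :: "'a set" and E :: "'a set set" and k :: nat and \<kappa> :: "'a set \<Rightarrow> nat"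
  assumes "fin_simple_graph V E"
    and "proper_edge_coloring E k \<kappa>"
  shows "(sym_group_on V)\<lparr>carrier := centralizer (sym_group_on V) (coloring_group V E k \<kappa>)\<rparr>
       \<cong> (sym_group_on V)\<lparr>carrier := color_aut V E k \<kappa>\<rparr>"
  unfolding centralizer_coloring_group[OF assms] by (rule iso_refl)

end
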